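(* Let $T>0$ and let $X$ be a Banach space. For $\alpha\in(0,1)$ and $p,q\in[1,\infty)$, with $q>p/\alpha$, we have the strict inclusion $L^q(0,T;X)\subsetneq L^p_\alpha(0,T;X)$. Furthermore, for all $v\in L^q(0,T;X)$, it holds that $$\|v\|_{L^p_\alpha(0,T;X)}\le\left(\frac{q-p}{\alpha q-p}\right)^{(q-p)/(pq)}\left(\frac{T^{(\alpha q-p)/(pq)}}{\Gamma(\alpha)^{1/p}}\right)\|v\|_{L^q(0,T;X)}.$$ Additionally, we have $$L^p_\alpha(0,T;X)\nsubseteq L^{p/\alpha}(0,T;X)\quad\text{and}\quad L^{p/\alpha}(0,T;X)\nsubseteq L^p_\alpha(0,T;X).$$
   Context: For $\alpha\in(0,1]$ and $p\in[1,\infty)$, $L^p_\alpha(0,T;X)$ is the space of all Bochner measurable functions $v:[0,T]\to X$ such that $\int_0^T\frac{(T-s)^{\alpha-1}}{\Gamma(\alpha)}\|v(s)\|_X^p\,ds<\infty$, with norm $\|v\|_{L^p_\alpha(0,T;X)}=\left(\int_0^T\frac{(T-s)^{\alpha-1}}{\Gamma(\alpha)}\|v(s)\|_X^p\,ds\right)^{1/p}$. For $r\in[1,\infty)$, $L^r(0,T;X)$ is the usual Bochner-Lebesgue space of Bochner measurable functions $v:[0,T]\to X$ with $\|v(\cdot)\|_X\in L^r(0,T;\mathbb{R})$, with norm $\|v\|_{L^r(0,T;X)}=\left(\int_0^T\|v(t)\|_X^r\,dt\right)^{1/r}$. $\Gamma$ is the Gamma function. *)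

theory Defs
  imports "HOL-Analysis.Analysis"
begin

(* Bochner (strong) measurability: almost everywhere limit of simple functions.  For a
   non-separable Banach space this is stronger than Borel measurability, and the library's
   vector-valued integration theory only covers second countable spaces. *)
definition bochner_measurable :: "'s measure \<Rightarrow> ('s \<Rightarrow> 'a::banach) \<Rightarrow> bool" where
  "bochner_measurable M v \<longleftrightarrow>
     (\<exists>\<phi> :: nat \<Rightarrow> 's \<Rightarrow> 'a. (\<forall>n. simple_function M (\<phi> n)) \<and>
        (AE s in M. (\<lambda>n. \<phi> n s) \<longlonglongrightarrow> v s))"

(* A function on [0,T] is represented by any function on the reals; neither membership in the
   spaces below nor the norms depend on its values outside [0,T].  As usual, functions stand
   for their almost-everywhere classes. *)
definition L_space :: "real \<Rightarrow> real \<Rightarrow> (real \<Rightarrow> 'a::banach) set" where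
  "L_space T r =
     {v. bochner_measurable (lebesgue_on {0..T}) v \<and>
         integrable (lebesgue_on {0..T}) (\<lambda>t. norm (v t) powr r)}"

definition L_norm :: "real \<Rightarrow> real \<Rightarrow> (real \<Rightarrow> 'a::banach) \<Rightarrow> real" where
  "L_norm T r v = (\<integral>t. norm (v t) powr r \<partial>lebesgue_on {0..T}) powr (1 / r)"

(* The value 0 powr (\<alpha> - 1) = 0 of the weight at s = T only concerns a null set. *)
definition frac_L_space :: "real \<Rightarrow> real \<Rightarrow> real \<Rightarrow> (real \<Rightarrow> 'a::banach) set" where
  "frac_L_space \<alpha> T p =
     {v. bochner_measurable (lebesgue_on {0..T}) v \<and>
         integrable (lebesgue_on {0..T})
           (\<lambda>s. (T - s) powr (\<alpha> - 1) / Gamma \<alpha> * norm (v s) powr p)}"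

definition frac_L_norm :: "real \<Rightarrow> real \<Rightarrow> real \<Rightarrow> (real \<Rightarrow> 'a::banach) \<Rightarrow> real" where
  "frac_L_norm \<alpha> T p v =
     (\<integral>s. (T - s) powr (\<alpha> - 1) / Gamma \<alpha> * norm (v s) powr p \<partial>lebesgue_on {0..T}) powr (1 / p)"

end

(* The inclusion and the bound are Hoelder's inequality with exponents q / (q - p) and q / p, applied
   to the weight and to the p-th power of the norm. The remaining claims come from multiples of a unit
   vector: a power singularity at 0, where the weight is bounded, lies in the weighted space but in no
   L^r with r >= p / alpha; a singularity at T, with a logarithmic factor at the borderline power,
   lies in L^(p / alpha) but not in the weighted space. *)
theory Submission
  imports Defs "HOL-Real_Asymp.Real_Asymp"
begin

section \<open>Hoelder's inequality for nonnegative real functions\<close>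

text \<open>Young's inequality, applied pointwise, gives an integrable majorant of the product.
  Applied again after both factors are normalised, it integrates to the bound.\<close>

lemma Holder_integral:
  fixes f g :: "'s \<Rightarrow> real"
  assumes ab: "1 < a" "1 < b" "1 / a + 1 / b = 1"
    and meas: "f \<in> borel_measurable M" "g \<in> borel_measurable M"
    and nonneg: "\<And>x. 0 \<le> f x" "\<And>x. 0 \<le> g x"
    and intf: "integrable M (\<lambda>x. f x powr a)" and intg: "integrable M (\<lambda>x. g x powr b)"
  shows "integrable M (\<lambda>x. f x * g x)"
    and "(\<integral>x. f x * g x \<partial>M) \<le> (\<integral>x. f x powr a \<partial>M) powr (1 / a) * (\<integral>x. g x powr b \<partial>M) powr (1 / b)"
proof -
  have young: "f x * g x \<le> f x powr a / a + g x powr b / b" for x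
    using Youngs_inequality[OF ab] nonneg by blast
  have int_sum: "integrable M (\<lambda>x. f x powr a / a + g x powr b / b)"
    using intf intg by simp
  show int: "integrable M (\<lambda>x. f x * g x)"
    by (rule Bochner_Integration.integrable_bound[OF int_sum])
       (use young meas nonneg ab in \<open>auto intro!: AE_I2 simp: abs_of_nonneg\<close>)
  define A where "A = (\<integral>x. f x powr a \<partial>M)"
  define B where "B = (\<integral>x. g x powr b \<partial>M)"
  have AB: "A \<ge> 0" "B \<ge> 0"
    unfolding A_def B_def by simp_all
  have "(\<integral>x. f x * g x \<partial>M) \<le> A powr (1 / a) * B powr (1 / b)"
  \<comment> \<open>Normalisation divides by powers of \<open>A\<close> and \<open>B\<close>. If one
    of them vanishes, that factor is zero almost everywhere, and so is the product.\<close>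
  proof (cases "A = 0 \<or> B = 0")
    case True
    then have "AE x in M. f x * g x = 0"
    proof
      assume "A = 0"
      then have "AE x in M. f x powr a = 0"
        using integral_nonneg_eq_0_iff_AE[OF intf] by (simp add: A_def)
      then show ?thesis by eventually_elim simp
    next
      assume "B = 0"
      then have "AE x in M. g x powr b = 0"
        using integral_nonneg_eq_0_iff_AE[OF intg] by (simp add: B_def)
      then show ?thesis by eventually_elim simp
    qed
    then have "(\<integral>x. f x * g x \<partial>M) = 0"
      by (rule integral_eq_zero_AE)
    then show ?thesis by simp
  next
    case False
    with AB have pos: "A > 0" "B > 0" by auto
    define c where "c = A powr (1 / a) * B powr (1 / b)"
    have c: "c > 0" using pos by (simp add: c_def)
    \<comment> \<open>Each normalised factor has integral 1 after raising to its exponent, so the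
      right-hand side integrates to \<open>1 / a + 1 / b = 1\<close>.\<close>
    have "f x * g x / c \<le> f x powr a / (a * A) + g x powr b / (b * B)" for x
    proof -
      have "(f x / A powr (1 / a)) * (g x / B powr (1 / b))
          \<le> (f x / A powr (1 / a)) powr a / a + (g x / B powr (1 / b)) powr b / b"
        by (rule Youngs_inequality[OF ab]) (use nonneg in auto)
      moreover have "(f x / A powr (1 / a)) powr a = f x powr a / A"
        "(g x / B powr (1 / b)) powr b = g x powr b / B"
        using ab pos nonneg by (simp_all add: powr_divide powr_powr)
      ultimately show ?thesis
        by (simp add: c_def mult.commute)
    qed
    then have "(\<integral>x. f x * g x / c \<partial>M) \<le> (\<integral>x. f x powr a / (a * A) + g x powr b / (b * B) \<partial>M)"
      using int intf intg by (intro integral_mono) auto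
    also have "\<dots> = A / (a * A) + B / (b * B)"
      using intf intg by (simp add: A_def B_def)
    also have "\<dots> = 1"
      using pos ab by simp
    finally show ?thesis
      using c by (simp add: c_def)
  qed
  then show "(\<integral>x. f x * g x \<partial>M) \<le> (\<integral>x. f x powr a \<partial>M) powr (1 / a) * (\<integral>x. g x powr b \<partial>M) powr (1 / b)"
    by (simp add: A_def B_def)
qed

section \<open>Reflection, integrability tests and measurability\<close>

text \<open>Moves a singularity at \<open>T\<close> to 0, so that all antiderivatives are studied at
  0 only.\<close>

lemma has_integral_reflect_0:
  fixes f :: "real \<Rightarrow> real"
  assumes "(f has_integral I) {0..T}"
  shows "((\<lambda>s. f (T - s)) has_integral I) {0..T}"
proof -
  have "(\<lambda>x::real. T - x) ` {0..T} = {0..T}"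
    by (auto intro!: image_eqI[where x = "T - _"])
  then show ?thesis
    using has_integral_affinity[of f I 0 T "-1" T] assms by simp
qed

lemma integrable_on_reflect_0:
  fixes f :: "real \<Rightarrow> real"
  assumes "f integrable_on {0..T}"
  shows "(\<lambda>s. f (T - s)) integrable_on {0..T}"
  using has_integral_reflect_0[OF integrable_integral[OF assms]] by (rule has_integral_integrable)

text \<open>For a nonnegative function, gauge integrability is absolute. Questions about the
  function spaces can thus be settled by the fundamental theorem of calculus.\<close>

lemma integrable_lebesgue_on_nonneg:
  fixes f :: "real \<Rightarrow> real"
  assumes "\<And>x. x \<in> {a..b} \<Longrightarrow> 0 \<le> f x"
  shows "integrable (lebesgue_on {a..b}) f \<longleftrightarrow> f integrable_on {a..b}"
  using absolutely_integrable_on_iff_nonneg[of "{a..b}" f] assms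
  by (simp add: set_integrable_def integrable_restrict_space)

text \<open>By nonnegativity, \<open>F T - F x\<close> is an integral over \<open>{x..T}\<close> and
  is bounded by the integral over \<open>{0..T}\<close>, whereas it grows without bound as
  \<open>x\<close> tends to 0.\<close>

lemma not_integrable_unbounded_antiderivative:
  fixes f F :: "real \<Rightarrow> real"
  assumes "0 < T"
    and nonneg: "\<And>x. x \<in> {0..T} \<Longrightarrow> 0 \<le> f x"
    and deriv: "\<And>x. x \<in> {0<..T} \<Longrightarrow> (F has_real_derivative f x) (at x)"
    and lim: "filterlim F at_bot (at_right 0)"
  shows "\<not> f integrable_on {0..T}"
proof
  assume int: "f integrable_on {0..T}"
  have "eventually (\<lambda>x. F x < F T - integral {0..T} f) (at_right 0)"
    using lim by (simp add: filterlim_at_bot_dense)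
  moreover have "eventually (\<lambda>x. x \<in> {0<..<T}) (at_right 0)"
    using \<open>0 < T\<close> by (rule eventually_at_right_real)
  ultimately have "eventually (\<lambda>x. False) (at_right (0::real))"
  proof eventually_elim
    case (elim x)
    have "(f has_integral (F T - F x)) {x..T}"
      using elim deriv
      by (intro fundamental_theorem_of_calculus)
         (auto simp: has_real_derivative_iff_has_vector_derivative[symmetric] intro: has_field_derivative_at_within)
    moreover from this have "integral {x..T} f \<le> integral {0..T} f"
      using elim nonneg by (intro integral_subset_le int) auto
    ultimately show False using elim by (simp add: integral_unique)
  qed
  then show False by (simp add: trivial_limit_at_right_real)
qed

text \<open>Simple approximations of the scalar factor stay simple when multiplied by a fixed
  vector, whether or not the Banach space is separable.\<close>

lemma bochner_measurable_scaleR: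
  fixes g :: "'s \<Rightarrow> real" and x :: "'a::banach"
  assumes "g \<in> borel_measurable M"
  shows "bochner_measurable M (\<lambda>s. g s *\<^sub>R x)"
proof -
  obtain F where "\<And>i. simple_function M (F i)" "\<And>s. s \<in> space M \<Longrightarrow> (\<lambda>i. F i s) \<longlonglongrightarrow> g s"
    using borel_measurable_implies_sequence_metric[OF assms, of 0] by blast
  then show ?thesis
    unfolding bochner_measurable_def
    by (intro exI[of _ "\<lambda>i s. F i s *\<^sub>R x"])
       (auto intro!: AE_I2 tendsto_intros simple_function_compose1[where g = "\<lambda>r. r *\<^sub>R x"])
qed

section \<open>Powers and logarithmic factors at 0\<close>

lemma not_integrable_powr_0:
  fixes e T :: real
  assumes "0 < T" "e \<le> -1"
  shows "\<not> (\<lambda>s. s powr e) integrable_on {0..T}"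
proof (cases "e = -1")
  case True
  show ?thesis
    unfolding True
  proof (rule not_integrable_unbounded_antiderivative[OF \<open>0 < T\<close>])
    show "(ln has_real_derivative x powr -1) (at x)" if "x \<in> {0<..T}" for x
      using that by (auto intro!: derivative_eq_intros simp: powr_minus inverse_eq_divide)
  qed (use ln_at_0 in auto)
next
  case False
  with assms have e: "e + 1 < 0" by simp
  show ?thesis
  proof (rule not_integrable_unbounded_antiderivative[OF \<open>0 < T\<close>])
    show "((\<lambda>s. s powr (e + 1) / (e + 1)) has_real_derivative x powr e) (at x)"
      if "x \<in> {0<..T}" for x
      using that e by (auto intro!: derivative_eq_intros)
    show "filterlim (\<lambda>s. s powr (e + 1) / (e + 1)) at_bot (at_right 0)"
      using e by real_asymp
  qed auto
qed

text \<open>The shift by 1 keeps the logarithmic factor away from 0 up to the endpoint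
  \<open>u = T\<close>, so its real powers and its logarithm can be differentiated there.\<close>

lemma one_plus_ln_pos:
  fixes T u :: real
  assumes "0 < u" "u \<le> T"
  shows "0 < 1 + ln (T / u)"
proof -
  have "0 \<le> ln (T / u)" using assms by simp
  then show ?thesis by linarith
qed

text \<open>The antiderivative \<open>(1 + ln (T / u)) powr (1 - c) / (c - 1)\<close> tends to 0 at
  0 because \<open>1 < c\<close>. Extended by that limit it is continuous on \<open>{0..T}\<close>,
  and the derivative is required only in the interior.\<close>

lemma integrable_log_powr:
  fixes T c :: real
  assumes "0 < T" "1 < c"
  shows "(\<lambda>u. u powr -1 * (1 + ln (T / u)) powr - c) integrable_on {0..T}"
proof -
  \<comment> \<open>At \<open>u = 0\<close> the quotient \<open>T / u\<close> is 0 by convention, so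
    the formula does not produce the limit there; the value 0 is set by hand.\<close>
  define F where "F u = (if u \<le> 0 then 0 else (1 + ln (T / u)) powr (1 - c) / (c - 1))" for u
  have lim: "((\<lambda>u. (1 + ln (T / u)) powr (1 - c) / (c - 1)) \<longlongrightarrow> 0) (at_right 0)"
    using assms by real_asymp
  have ev: "\<forall>\<^sub>F y in nhds x. F y = (1 + ln (T / y)) powr (1 - c) / (c - 1)" if "0 < x" for x
    using eventually_nhds_in_open[of "{0<..}" x] that
    by (auto elim!: eventually_mono simp: F_def)
  have deriv: "(F has_real_derivative x powr -1 * (1 + ln (T / x)) powr - c) (at x)"
    if "0 < x" "x \<le> T" for x
  proof -
    have "((\<lambda>u. 1 + ln (T / u)) has_real_derivative - (1 / x)) (at x)"
      using that assms by (auto intro!: derivative_eq_intros simp: field_simps power2_eq_square)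
    from DERIV_cdivide[OF DERIV_fun_powr[OF this one_plus_ln_pos[OF that], of "1 - c"], of "c - 1"]
    have "((\<lambda>u. (1 + ln (T / u)) powr (1 - c) / (c - 1)) has_real_derivative
        x powr -1 * (1 + ln (T / x)) powr - c) (at x)"
    proof (rule DERIV_cong)
      have "(1 - c) * A * - (1 / x) / (c - 1) = x powr -1 * A" for A
        using that assms by (simp add: powr_minus field_simps)
      then show "(1 - c) * (1 + ln (T / x)) powr (1 - c - real 1) * - (1 / x) / (c - 1)
          = x powr -1 * (1 + ln (T / x)) powr - c"
        by simp
    qed
    then show ?thesis
      using DERIV_cong_ev[OF refl ev[OF \<open>0 < x\<close>] refl] by simp
  qed
  have "continuous_on {0..T} F"
    unfolding continuous_on_def
  proof
    fix x assume x: "x \<in> {0..T}"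
    show "(F \<longlongrightarrow> F x) (at x within {0..T})"
    proof (cases "x = 0")
      case True
      have "\<forall>\<^sub>F u in at_right 0. (1 + ln (T / u)) powr (1 - c) / (c - 1) = F u"
        by (auto simp: eventually_at_filter F_def)
      then have "(F \<longlongrightarrow> 0) (at_right 0)"
        using lim by (rule Lim_transform_eventually[rotated])
      then show ?thesis
        using True at_within_Icc_at_right[OF \<open>0 < T\<close>] by (simp add: F_def)
    next
      case False
      with x deriv[of x] have "isCont F x" by (auto intro: DERIV_isCont)
      then show ?thesis
        by (simp add: continuous_at_imp_continuous_within continuous_within[symmetric])
    qed
  qed
  then have "((\<lambda>u. u powr -1 * (1 + ln (T / u)) powr - c) has_integral F T - F 0) {0..T}"
    using assms deriv
    by (intro fundamental_theorem_of_calculus_interior)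
       (auto simp only: has_real_derivative_iff_has_vector_derivative[symmetric] greaterThanLessThan_iff)
  then show ?thesis
    by (rule has_integral_integrable)
qed

text \<open>At the exponent \<open>c = 1\<close> the antiderivative is an iterated logarithm, which
  still diverges at 0.\<close>

lemma not_integrable_log:
  fixes T :: real
  assumes "0 < T"
  shows "\<not> (\<lambda>u. u powr -1 * (1 + ln (T / u)) powr -1) integrable_on {0..T}"
proof (rule not_integrable_unbounded_antiderivative[OF assms])
  show "((\<lambda>u. - ln (1 + ln (T / u))) has_real_derivative x powr -1 * (1 + ln (T / x)) powr -1) (at x)"
    if "x \<in> {0<..T}" for x
    using that one_plus_ln_pos[of x T] assms
    by (auto intro!: derivative_eq_intros simp: powr_minus field_simps power2_eq_square)
  show "filterlim (\<lambda>u. - ln (1 + ln (T / u))) at_bot (at_right 0)"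
    using assms by real_asymp
qed auto

section \<open>Integrals of the weight, alone and against a power singular at 0\<close>

text \<open>With \<open>e = (\<alpha> - 1) * q / (q - p)\<close>, this value is the source of the
  powers of \<open>T\<close> and of \<open>(q - p) / (\<alpha> * q - p)\<close> in the norm
  bound.\<close>

lemma integrable_powr_reflect:
  fixes T e :: real
  assumes "0 < T" "-1 < e"
  shows "integrable (lebesgue_on {0..T}) (\<lambda>s. (T - s) powr e)"
    and "(\<integral>s. (T - s) powr e \<partial>lebesgue_on {0..T}) = T powr (e + 1) / (e + 1)"
proof -
  have I: "((\<lambda>s. (T - s) powr e) has_integral T powr (e + 1) / (e + 1)) {0..T}"
    using has_integral_reflect_0[OF has_integral_powr_from_0[of e T]] assms by simp
  then show int: "integrable (lebesgue_on {0..T}) (\<lambda>s. (T - s) powr e)"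
    by (subst integrable_lebesgue_on_nonneg) auto
  show "(\<integral>s. (T - s) powr e \<partial>lebesgue_on {0..T}) = T powr (e + 1) / (e + 1)"
    using lebesgue_integral_eq_integral[OF int] I by (simp add: integral_unique)
qed

lemma borel_measurable_lebesgue_on:
  "f \<in> borel_measurable borel \<Longrightarrow> f \<in> borel_measurable (lebesgue_on S)"
  by (simp add: measurable_restrict_space1 measurable_completion)

text \<open>The two singularities lie at opposite ends. On each side of \<open>T / 2\<close> one
  factor is at most its value at the midpoint, and the sum of the two resulting bounds is an
  integrable majorant.\<close>

lemma integrable_powr_mult_reflect_powr:
  fixes T \<alpha> :: real
  assumes "0 < T" "0 < \<alpha>" "\<alpha> < 1"
  shows "integrable (lebesgue_on {0..T}) (\<lambda>s. (T - s) powr (\<alpha> - 1) * s powr - \<alpha>)"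
proof (rule Bochner_Integration.integrable_bound)
  have "integrable (lebesgue_on {0..T}) (\<lambda>s. s powr - \<alpha>)"
    using integrable_on_powr_from_0[of "- \<alpha>" T] assms
    by (subst integrable_lebesgue_on_nonneg) auto
  then show "integrable (lebesgue_on {0..T})
      (\<lambda>s. (T / 2) powr (\<alpha> - 1) * s powr - \<alpha> + (T / 2) powr - \<alpha> * (T - s) powr (\<alpha> - 1))"
    using integrable_powr_reflect(1)[of T "\<alpha> - 1"] assms by simp
  show "(\<lambda>s. (T - s) powr (\<alpha> - 1) * s powr - \<alpha>) \<in> borel_measurable (lebesgue_on {0..T})"
    by (intro borel_measurable_lebesgue_on) measurable
  have "(T - s) powr (\<alpha> - 1) * s powr - \<alpha>
      \<le> (T / 2) powr (\<alpha> - 1) * s powr - \<alpha> + (T / 2) powr - \<alpha> * (T - s) powr (\<alpha> - 1)" for s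
  proof (cases "s \<le> T / 2")
    case True
    then have "(T - s) powr (\<alpha> - 1) \<le> (T / 2) powr (\<alpha> - 1)"
      using assms by (intro powr_mono2') auto
    then show ?thesis
      by (intro add_increasing2 mult_right_mono) auto
  next
    case False
    then have "s powr - \<alpha> \<le> (T / 2) powr - \<alpha>"
      using assms by (intro powr_mono2') auto
    then have "s powr - \<alpha> * (T - s) powr (\<alpha> - 1) \<le> (T / 2) powr - \<alpha> * (T - s) powr (\<alpha> - 1)"
      by (rule mult_right_mono) simp
    then show ?thesis
      by (simp add: mult.commute add_increasing)
  qed
  then show "AE s in lebesgue_on {0..T}. norm ((T - s) powr (\<alpha> - 1) * s powr - \<alpha>)
      \<le> norm ((T / 2) powr (\<alpha> - 1) * s powr - \<alpha> + (T / 2) powr - \<alpha> * (T - s) powr (\<alpha> - 1))"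
    by (intro AE_I2) simp
qed

section \<open>The inclusion and the norm bound\<close>

lemma L_space_frac_L:
  fixes v :: "real \<Rightarrow> 'a::banach"
  assumes T: "0 < T" and \<alpha>: "0 < \<alpha>" "\<alpha> < 1" and p: "1 \<le> p" and q: "p / \<alpha> < q"
    and v: "v \<in> L_space T q"
  shows "v \<in> frac_L_space \<alpha> T p"
    and "frac_L_norm \<alpha> T p v
      \<le> ((q - p) / (\<alpha> * q - p)) powr ((q - p) / (p * q))
        * (T powr ((\<alpha> * q - p) / (p * q)) / Gamma \<alpha> powr (1 / p)) * L_norm T q v"
proof -
  let ?M = "lebesgue_on {0..T}"
  have pq: "p < \<alpha> * q"
    using q \<alpha> by (simp add: field_simps)
  have q0: "0 < q"
    using q p \<alpha> by (smt (verit) divide_pos_pos)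
  have "\<alpha> * q < q"
    using q0 \<alpha> by simp
  with pq have "p < q" by simp
  have \<Gamma>: "0 < Gamma \<alpha>"
    using \<alpha> by (simp add: Gamma_real_pos)
  define a where "a = q / (q - p)"
  define b where "b = q / p"
  \<comment> \<open>The exponent of the weight raised to the power \<open>a\<close>. Integrability
    requires \<open>e > -1\<close>, which is where \<open>p / \<alpha> < q\<close> enters.\<close>
  define e where "e = (\<alpha> - 1) * a"
  define N where "N = (\<integral>s. norm (v s) powr q \<partial>?M)"
  have ab: "1 < a" "1 < b" "1 / a + 1 / b = 1"
    using \<open>p < q\<close> p by (auto simp: a_def b_def divide_simps)
  have e1: "e + 1 = (\<alpha> * q - p) / (q - p)"
    using \<open>p < q\<close> by (simp add: e_def a_def field_simps)
  also have "\<dots> > 0"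
    using \<open>p < q\<close> pq by simp
  finally have e: "- 1 < e" by simp
  have intv: "integrable ?M (\<lambda>s. norm (v s) powr q)"
    and bv: "bochner_measurable ?M v"
    using v by (auto simp: L_space_def)
  have N: "0 \<le> N"
    by (simp add: N_def)
  \<comment> \<open>Measurability of the \<open>p\<close>-th power comes from the integrable
    \<open>q\<close>-th power through the exponent \<open>p / q\<close>, which avoids unfolding
    Bochner measurability.\<close>
  have "(\<lambda>s. (norm (v s) powr q) powr (p / q)) \<in> borel_measurable ?M"
    using borel_measurable_integrable[OF intv] by measurable
  then have meas: "(\<lambda>s. norm (v s) powr p) \<in> borel_measurable ?M"
    using q0 by (simp add: powr_powr)
  have measw: "(\<lambda>s. (T - s) powr (\<alpha> - 1)) \<in> borel_measurable ?M"
    by (intro borel_measurable_lebesgue_on) measurable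
  have pw: "((T - s) powr (\<alpha> - 1)) powr a = (T - s) powr e"
    "(norm (v s) powr p) powr b = norm (v s) powr q" for s
    using p by (simp_all add: powr_powr e_def b_def)
  have wint: "integrable ?M (\<lambda>s. ((T - s) powr (\<alpha> - 1)) powr a)"
    and vint: "integrable ?M (\<lambda>s. (norm (v s) powr p) powr b)"
    using integrable_powr_reflect(1)[OF T e] intv by (simp_all only: pw)
  note H = Holder_integral[OF ab measw meas powr_ge_zero powr_ge_zero wint vint]
  define I where "I = (\<integral>s. (T - s) powr (\<alpha> - 1) * norm (v s) powr p \<partial>?M)"
  have int: "integrable ?M (\<lambda>s. (T - s) powr (\<alpha> - 1) / Gamma \<alpha> * norm (v s) powr p)"
    using integrable_divide_zero[OF H(1), of "Gamma \<alpha>"] by simp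
  then show "v \<in> frac_L_space \<alpha> T p"
    using bv by (simp add: frac_L_space_def)
  have I: "I \<le> (T powr (e + 1) / (e + 1)) powr (1 / a) * N powr (1 / b)"
    using H(2) by (simp add: pw integrable_powr_reflect(2)[OF T e] I_def N_def)
  have "0 \<le> I"
    by (simp add: I_def)
  have "frac_L_norm \<alpha> T p v = (I / Gamma \<alpha>) powr (1 / p)"
    by (simp add: frac_L_norm_def I_def)
  also have "\<dots> \<le> ((T powr (e + 1) / (e + 1)) powr (1 / a) * N powr (1 / b) / Gamma \<alpha>) powr (1 / p)"
    using I \<open>0 \<le> I\<close> \<Gamma> p by (intro powr_mono2 divide_right_mono) auto
  \<comment> \<open>Here \<open>1 / (a * p) = (q - p) / (p * q)\<close> and
    \<open>1 / (b * p) = 1 / q\<close>.\<close>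
  also have "\<dots> = (T powr (e + 1) / (e + 1)) powr ((q - p) / (p * q)) * N powr (1 / q) / Gamma \<alpha> powr (1 / p)"
    using \<Gamma> N p e by (simp add: powr_divide powr_mult powr_powr a_def b_def mult.commute)
  also have "(T powr (e + 1) / (e + 1)) powr ((q - p) / (p * q))
      = (1 / (e + 1)) powr ((q - p) / (p * q)) * T powr ((e + 1) * ((q - p) / (p * q)))"
    using e by (simp add: powr_divide powr_powr)
  also have "(e + 1) * ((q - p) / (p * q)) = (\<alpha> * q - p) / (p * q)"
    using \<open>p < q\<close> by (simp add: e1)
  also have "1 / (e + 1) = (q - p) / (\<alpha> * q - p)"
    by (simp add: e1)
  finally show "frac_L_norm \<alpha> T p v
      \<le> ((q - p) / (\<alpha> * q - p)) powr ((q - p) / (p * q))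
        * (T powr ((\<alpha> * q - p) / (p * q)) / Gamma \<alpha> powr (1 / p)) * L_norm T q v"
    by (simp add: L_norm_def N_def)
qed

section \<open>Functions separating the spaces\<close>

text \<open>The \<open>p\<close>-th power of the norm is \<open>s powr - \<alpha>\<close>,
  integrable against the weight, while the \<open>r\<close>-th power has exponent
  \<open>- \<alpha> * r / p\<close>, at most -1 once \<open>p / \<alpha> \<le> r\<close>. General
  \<open>r\<close> covers both strictness (\<open>r = q\<close>) and the non-inclusion
  (\<open>r = p / \<alpha>\<close>).\<close>

lemma in_frac_not_in_L_space:
  fixes w :: "'a::banach"
  assumes "0 < T" "0 < \<alpha>" "\<alpha> < 1" "1 \<le> p" "norm w = 1"
  defines "v \<equiv> \<lambda>s. s powr (- \<alpha> / p) *\<^sub>R w"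
  shows "v \<in> frac_L_space \<alpha> T p"
    and "p / \<alpha> \<le> r \<Longrightarrow> v \<notin> L_space T r"
proof -
  have norm_v: "norm (v s) powr r = s powr (- \<alpha> / p * r)" for s r
    using assms by (simp add: powr_powr)
  have "bochner_measurable (lebesgue_on {0..T}) v"
    unfolding v_def by (intro bochner_measurable_scaleR borel_measurable_lebesgue_on) measurable
  moreover have "integrable (lebesgue_on {0..T})
      (\<lambda>s. (T - s) powr (\<alpha> - 1) / Gamma \<alpha> * norm (v s) powr p)"
    using integrable_powr_mult_reflect_powr[OF assms(1-3)] assms(4)
    by (simp add: norm_v)
  ultimately show "v \<in> frac_L_space \<alpha> T p"
    by (simp add: frac_L_space_def)
  show "v \<notin> L_space T r" if "p / \<alpha> \<le> r"
  proof -
    have "- \<alpha> / p * r \<le> -1"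
      using that assms by (simp add: field_simps)
    from not_integrable_powr_0[OF \<open>0 < T\<close> this] show ?thesis
      using integrable_lebesgue_on_nonneg[of 0 T "\<lambda>s. norm (v s) powr r"]
      by (simp add: L_space_def norm_v)
  qed
qed

text \<open>With \<open>u = T - s\<close>, the \<open>p\<close>-th power of the norm is \<open>u powr - \<alpha> / (1 + ln (T / u))\<close>. Its power
  \<open>1 / \<alpha>\<close> raises the logarithm to an exponent above 1, whereas the weight only completes
  \<open>u powr - \<alpha>\<close> to \<open>1 / u\<close> and leaves the logarithm to the first power.\<close>

lemma in_L_not_in_frac_L_space:
  fixes w :: "'a::banach"
  assumes "0 < T" "0 < \<alpha>" "\<alpha> < 1" "1 \<le> p" "norm w = 1"
  defines "v \<equiv> \<lambda>s. ((T - s) powr (- \<alpha> / p) * (1 + ln (T / (T - s))) powr (- 1 / p)) *\<^sub>R w"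
  shows "v \<in> L_space T (p / \<alpha>)"
    and "v \<notin> frac_L_space \<alpha> T p"
proof -
  have norm_v: "norm (v s) powr r
      = (T - s) powr (- \<alpha> / p * r) * (1 + ln (T / (T - s))) powr (- 1 / p * r)" for s r
    using assms by (simp add: powr_powr powr_mult abs_mult)
  have "bochner_measurable (lebesgue_on {0..T}) v"
    unfolding v_def by (intro bochner_measurable_scaleR borel_measurable_lebesgue_on) measurable
  moreover have "(\<lambda>s. (T - s) powr -1 * (1 + ln (T / (T - s))) powr - (1 / \<alpha>)) integrable_on {0..T}"
    using integrable_on_reflect_0[OF integrable_log_powr[of T "1 / \<alpha>"]] assms(1-3) by simp
  then have "integrable (lebesgue_on {0..T}) (\<lambda>s. norm (v s) powr (p / \<alpha>))"
    using assms(1-4) by (subst integrable_lebesgue_on_nonneg) (auto simp: norm_v)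
  ultimately show "v \<in> L_space T (p / \<alpha>)"
    by (simp add: L_space_def)
  show "v \<notin> frac_L_space \<alpha> T p"
  proof
    assume "v \<in> frac_L_space \<alpha> T p"
    \<comment> \<open>Clearing the constant \<open>Gamma \<alpha>\<close> leaves exactly the
      reflection of the integrand excluded by \<open>not_integrable_log\<close>.\<close>
    then have "integrable (lebesgue_on {0..T})
        (\<lambda>s. Gamma \<alpha> * ((T - s) powr (\<alpha> - 1) / Gamma \<alpha> * norm (v s) powr p))"
      unfolding frac_L_space_def by (intro Bochner_Integration.integrable_mult_right) blast
    moreover have "Gamma \<alpha> * ((T - s) powr (\<alpha> - 1) / Gamma \<alpha> * norm (v s) powr p)
        = (T - s) powr -1 * (1 + ln (T / (T - s))) powr -1" for s
    proof -
      have "Gamma \<alpha> \<noteq> 0"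
        using Gamma_real_pos[OF assms(2)] by linarith
      moreover have "(T - s) powr (\<alpha> - 1) * (T - s) powr - \<alpha> = (T - s) powr -1"
        by (simp flip: powr_add)
      moreover have "norm (v s) powr p = (T - s) powr - \<alpha> * (1 + ln (T / (T - s))) powr -1"
        using assms(4) by (simp add: norm_v)
      ultimately show ?thesis by simp
    qed
    ultimately have "(\<lambda>s. (T - s) powr -1 * (1 + ln (T / (T - s))) powr -1) integrable_on {0..T}"
      by (simp add: integrable_lebesgue_on_nonneg)
    from integrable_on_reflect_0[OF this] show False
      using not_integrable_log[OF \<open>0 < T\<close>] by simp
  qed
qed

theorem theorem25:
  fixes T \<alpha> p q :: real
  assumes "T > 0"
    and "(UNIV :: 'a::banach set) \<noteq> {0}"
    and "0 < \<alpha>" "\<alpha> < 1"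
    and "1 \<le> p" "1 \<le> q"
    and "q > p / \<alpha>"
  shows "(L_space T q :: (real \<Rightarrow> 'a) set) \<subset> frac_L_space \<alpha> T p
    \<and> (\<forall>v \<in> (L_space T q :: (real \<Rightarrow> 'a) set).
         frac_L_norm \<alpha> T p v
           \<le> ((q - p) / (\<alpha> * q - p)) powr ((q - p) / (p * q))
              * (T powr ((\<alpha> * q - p) / (p * q)) / Gamma \<alpha> powr (1 / p))
              * L_norm T q v)
    \<and> \<not> (frac_L_space \<alpha> T p :: (real \<Rightarrow> 'a) set) \<subseteq> L_space T (p / \<alpha>)
    \<and> \<not> (L_space T (p / \<alpha>) :: (real \<Rightarrow> 'a) set) \<subseteq> frac_L_space \<alpha> T p"
proof -
  from assms(2) obtain x :: 'a where "x \<noteq> 0" by blast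
  \<comment> \<open>The witness is \<open>sgn x\<close>; it carries all the counterexamples.\<close>
  then obtain w :: 'a where w: "norm w = 1"
    by (metis norm_sgn)
  note frac = in_frac_not_in_L_space[OF \<open>T > 0\<close> \<open>0 < \<alpha>\<close> \<open>\<alpha> < 1\<close> \<open>1 \<le> p\<close> w]
  note L = in_L_not_in_frac_L_space[OF \<open>T > 0\<close> \<open>0 < \<alpha>\<close> \<open>\<alpha> < 1\<close> \<open>1 \<le> p\<close> w]
  note sub = L_space_frac_L[OF \<open>T > 0\<close> \<open>0 < \<alpha>\<close> \<open>\<alpha> < 1\<close> \<open>1 \<le> p\<close> \<open>q > p / \<alpha>\<close>]
  have "(L_space T q :: (real \<Rightarrow> 'a) set) \<subset> frac_L_space \<alpha> T p"
    using sub(1) frac(1) frac(2)[of q] \<open>q > p / \<alpha>\<close> by (blast intro: less_imp_le)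
  moreover have "\<not> (frac_L_space \<alpha> T p :: (real \<Rightarrow> 'a) set) \<subseteq> L_space T (p / \<alpha>)"
    using frac(1) frac(2)[of "p / \<alpha>"] by blast
  moreover have "\<not> (L_space T (p / \<alpha>) :: (real \<Rightarrow> 'a) set) \<subseteq> frac_L_space \<alpha> T p"
    using L by blast
  ultimately show ?thesis
    using sub(2) by blast
qed

end
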